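(* For all $k\geq1$: $\mathrm{BWT}_{k+1}\not\leq_W\mathrm{RT}_{1,k}'\times\lim$.
   Context: Weihrauch framework. A represented space is a set $X$ with a surjective partial map $\delta_X:\subseteq\mathbb{N}^{\mathbb{N}}\to X$. A problem is a partial multi-valued function $f:\subseteq X\rightrightarrows Y$; a partial $F:\subseteq\mathbb{N}^{\mathbb{N}}\to\mathbb{N}^{\mathbb{N}}$ realizes $f$ if $\delta_Y(F(p))\in f(\delta_X(p))$ whenever $\delta_X(p)\in\mathrm{dom}(f)$. With $\langle\cdot,\cdot\rangle$ a standard computable pairing on Baire space, $f\leq_W g$ means there are computable partial $H,K$ on Baire space such that $p\mapsto H\langle p,G(K(p))\rangle$ realizes $f$ for every realizer $G$ of $g$. The product $f\times g$ is $(x,w)\mapsto f(x)\times g(w)$. $\lim:\subseteq\mathbb{N}^{\mathbb{N}}\to\mathbb{N}^{\mathbb{N}}$ maps $\langle p_0,p_1,\dots\rangle$ (where $\langle p_0,p_1,\dots\rangle\langle i,j\rangle=p_i(j)$) to $\lim_i p_i$ if it exists. The jump $f'$ of $f$ is the same multi-valued map with input representation $\delta_X\circ\lim$. $\mathrm{BWT}_{m}:\{0,\dots,m-1\}^{\mathbb{N}}\rightrightarrows\{0,\dots,m-1\}$ maps a sequence to the set of values occurring infinitely often in it. $\mathrm{RT}_{1,k}$ maps a coloring $c:\mathbb{N}\to\{0,\dots,k-1\}$ (given as the sequence of its values, identifying $[\mathbb{N}]^1$ with $\mathbb{N}$) to the set of characteristic functions of infinite sets $M\subseteq\mathbb{N}$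 on which $c$ is constant. *)

theory Defs
  imports "HOL-Analysis.Function_Topology" "HOL-Library.Nat_Bijection"
begin

type_synonym baire = "nat \<Rightarrow> nat"

section \<open>Computable partial functions on Baire space\<close>

text \<open>
  Partial recursive functionals in the sense of Kleene: \<open>\<Phi> p xs\<close> is the value, if any, of an
  oracle computation on the numerical arguments \<open>xs\<close> with oracle \<open>p\<close>. The class is closed under
  composition, primitive recursion and unbounded minimisation uniformly in the oracle. Arities are
  not tracked: a functional may be undefined on argument lists of unsuitable length.
\<close>

type_synonym functional = "baire \<Rightarrow> nat list \<Rightarrow> nat option"

definition prec :: "functional \<Rightarrow> functional \<Rightarrow> functional" where
  "prec \<Phi> \<Psi> p xs = (case xs of [] \<Rightarrow> None
     | x # ys \<Rightarrow> rec_nat (\<Phi> p ys) (\<lambda>n r. Option.bind r (\<lambda>v. \<Psi> p (n # v # ys))) x)"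

definition minim :: "functional \<Rightarrow> functional" where
  "minim \<Phi> p xs =
     (let P = (\<lambda>n. \<Phi> p (n # xs) = Some 0 \<and> (\<forall>m<n. \<exists>v. \<Phi> p (m # xs) = Some (Suc v)))
      in if \<exists>n. P n then Some (THE n. P n) else None)"

inductive recursive :: "functional \<Rightarrow> bool" where
  query: "recursive (\<lambda>p xs. case xs of [x] \<Rightarrow> Some (p x) | _ \<Rightarrow> None)"
| zero: "recursive (\<lambda>p xs. Some 0)"
| succ: "recursive (\<lambda>p xs. case xs of [x] \<Rightarrow> Some (Suc x) | _ \<Rightarrow> None)"
| proj: "recursive (\<lambda>p xs. if i < length xs then Some (xs ! i) else None)"
| comp: "recursive \<Phi> \<Longrightarrow> \<forall>\<Psi>\<in>set \<Psi>s. recursive \<Psi> \<Longrightarrow>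
    recursive (\<lambda>p xs. Option.bind (those (map (\<lambda>\<Psi>. \<Psi> p xs) \<Psi>s)) (\<Phi> p))"
| prec: "recursive \<Phi> \<Longrightarrow> recursive \<Psi> \<Longrightarrow> recursive (prec \<Phi> \<Psi>)"
| minim: "recursive \<Phi> \<Longrightarrow> recursive (minim \<Phi>)"

text \<open>
  As usual in computable analysis, a machine for \<open>F\<close> may behave arbitrarily outside the domain
  of \<open>F\<close>; so restrictions of computable partial functions are computable.
\<close>

definition computable :: "(baire \<rightharpoonup> baire) \<Rightarrow> bool" where
  "computable F \<longleftrightarrow>
     (\<exists>\<Phi>. recursive \<Phi> \<and> (\<forall>p q. F p = Some q \<longrightarrow> (\<forall>n. \<Phi> p [n] = Some (q n))))"

section \<open>Pairing and limits on Baire space\<close>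

definition bpair :: "baire \<Rightarrow> baire \<Rightarrow> baire" where
  "bpair p q n = (if even n then p (n div 2) else q (n div 2))"

definition bfst :: "baire \<Rightarrow> baire" where
  "bfst r n = r (2 * n)"

definition bsnd :: "baire \<Rightarrow> baire" where
  "bsnd r n = r (2 * n + 1)"

lemma bfst_bpair [simp]: "bfst (bpair p q) = p"
  by (rule ext) (simp add: bfst_def bpair_def)

lemma bsnd_bpair [simp]: "bsnd (bpair p q) = q"
  by (rule ext) (simp add: bsnd_def bpair_def)

lemma bpair_collapse [simp]: "bpair (bfst r) (bsnd r) = r"
  by (rule ext) (auto simp: bfst_def bsnd_def bpair_def elim!: evenE oddE)

text \<open>\<open>column p i\<close> is the sequence $p_i$ where $p = \langle p_0, p_1, \ldots\rangle$.\<close>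

definition column :: "baire \<Rightarrow> nat \<Rightarrow> baire" where
  "column p i j = p (prod_encode (i, j))"

text \<open>Convergence is in the product topology on \<^typ>\<open>baire\<close>, with \<^typ>\<open>nat\<close> discrete.\<close>

definition lim_map :: "baire \<rightharpoonup> baire" where
  "lim_map p = (if convergent (column p) then Some (THE q. column p \<longlonglongrightarrow> q) else None)"

lemma baire_tendsto_iff:
  fixes X :: "nat \<Rightarrow> baire"
  shows "X \<longlonglongrightarrow> q \<longleftrightarrow> (\<forall>j. \<forall>\<^sub>F i in sequentially. X i j = q j)"
proof -
  have "X \<longlonglongrightarrow> q \<longleftrightarrow> (\<forall>j. (\<lambda>i. X i j) \<longlonglongrightarrow> q j)"
    using limitin_componentwise[where I = UNIV and X = "\<lambda>_. euclidean" and f = X and l = q and F = sequentially]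
    by (simp add: euclidean_product_topology)
  then show ?thesis
    by (simp add: tendsto_discrete)
qed

lemma baire_tendsto_unique:
  fixes X :: "nat \<Rightarrow> baire"
  assumes "X \<longlonglongrightarrow> q" "X \<longlonglongrightarrow> r"
  shows "q = r"
proof
  fix j
  have "\<forall>\<^sub>F i in sequentially. X i j = q j \<and> X i j = r j"
    using assms by (simp add: baire_tendsto_iff eventually_conj)
  then have "\<exists>i. X i j = q j \<and> X i j = r j"
    using eventually_happens'[OF sequentially_bot] by blast
  then show "q j = r j" by auto
qed

lemma lim_map_eq_Some_iff: "lim_map p = Some q \<longleftrightarrow> column p \<longlonglongrightarrow> q"
proof
  assume q: "column p \<longlonglongrightarrow> q"
  then have "(THE q. column p \<longlonglongrightarrow> q) = q"
    using baire_tendsto_unique by blast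
  then show "lim_map p = Some q"
    using q by (simp add: lim_map_def convergentI)
next
  assume eq: "lim_map p = Some q"
  then obtain r where r: "column p \<longlonglongrightarrow> r"
    by (auto simp: lim_map_def convergent_def split: if_splits)
  then have "(THE q. column p \<longlonglongrightarrow> q) = r"
    using baire_tendsto_unique by blast
  then show "column p \<longlonglongrightarrow> q"
    using eq r by (simp add: lim_map_def convergentI)
qed

section \<open>Problems and Weihrauch reducibility\<close>

text \<open>
  A represented space is given by its representation, a partial map on Baire space; the
  underlying set is the range of that map, so surjectivity holds by construction.
\<close>

type_synonym 'x representation = "baire \<rightharpoonup> 'x"

text \<open>
  The partial multi-valued map of a problem is a set-valued map \<open>f\<close>; its domain is the set of all
  \<open>x\<close> with \<open>f x \<noteq> {}\<close>.
\<close>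

record ('x, 'y) problem =
  in_rep :: "'x representation"
  out_rep :: "'y representation"
  sol :: "'x \<Rightarrow> 'y set"

definition realizes :: "(baire \<rightharpoonup> baire) \<Rightarrow> ('x, 'y) problem \<Rightarrow> bool" where
  "realizes F f \<longleftrightarrow>
     (\<forall>p x. in_rep f p = Some x \<and> sol f x \<noteq> {} \<longrightarrow>
        (\<exists>q y. F p = Some q \<and> out_rep f q = Some y \<and> y \<in> sol f x))"

definition weihrauch_le :: "('x, 'y) problem \<Rightarrow> ('u, 'v) problem \<Rightarrow> bool" (infix "\<le>\<^sub>W" 50) where
  "f \<le>\<^sub>W g \<longleftrightarrow>
     (\<exists>H K. computable H \<and> computable K \<and>
        (\<forall>G. realizes G g \<longrightarrow>
           realizes (\<lambda>p. Option.bind (K p) (\<lambda>r. Option.bind (G r) (\<lambda>s. H (bpair p s)))) f))"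

definition rep_prod :: "'x representation \<Rightarrow> 'u representation \<Rightarrow> ('x \<times> 'u) representation" where
  "rep_prod \<delta> \<epsilon> r =
     Option.bind (\<delta> (bfst r)) (\<lambda>x. Option.bind (\<epsilon> (bsnd r)) (\<lambda>u. Some (x, u)))"

definition problem_prod ::
  "('x, 'y) problem \<Rightarrow> ('u, 'v) problem \<Rightarrow> ('x \<times> 'u, 'y \<times> 'v) problem" (infixr "\<times>\<^sub>W" 80) where
  "f \<times>\<^sub>W g = \<lparr>in_rep = rep_prod (in_rep f) (in_rep g),
             out_rep = rep_prod (out_rep f) (out_rep g),
             sol = (\<lambda>(x, u). sol f x \<times> sol g u)\<rparr>"

definition jump :: "('x, 'y) problem \<Rightarrow> ('x, 'y) problem" where
  "jump f = \<lparr>in_rep = in_rep f \<circ>\<^sub>m lim_map, out_rep = out_rep f, sol = sol f\<rparr>"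

section \<open>The problems\<close>

definition seqs :: "nat \<Rightarrow> baire set" where
  "seqs m = {c. \<forall>n. c n < m}"

definition rep_seqs :: "nat \<Rightarrow> baire representation" where
  "rep_seqs m = Some |` seqs m"

definition rep_fin :: "nat \<Rightarrow> nat representation" where
  "rep_fin m p = (if p 0 < m then Some (p 0) else None)"

lemma ran_rep_seqs: "ran (rep_seqs m) = seqs m"
  by (auto simp: rep_seqs_def ran_def restrict_map_def)

lemma ran_rep_fin: "ran (rep_fin m) = {..<m}"
proof -
  have "rep_fin m (\<lambda>_. j) = Some j" if "j < m" for j
    using that by (simp add: rep_fin_def)
  then show ?thesis
    by (fastforce simp: ran_def rep_fin_def split: if_splits)
qed

definition lim_problem :: "(baire, baire) problem" where
  "lim_problem = \<lparr>in_rep = Some, out_rep = Some, sol = (\<lambda>p. set_option (lim_map p))\<rparr>"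

definition BWT :: "nat \<Rightarrow> (baire, nat) problem" where
  "BWT m = \<lparr>in_rep = rep_seqs m, out_rep = rep_fin m,
            sol = (\<lambda>c. {j. c \<in> seqs m \<and> infinite {n. c n = j}})\<rparr>"

text \<open>
  Solutions of \<open>RT1 k\<close> are characteristic functions, as points of the subspace
  $\{0,1\}^{\mathbb N}$ of Baire space.
\<close>

definition RT1 :: "nat \<Rightarrow> (baire, baire) problem" where
  "RT1 k = \<lparr>in_rep = rep_seqs k, out_rep = rep_seqs 2,
            sol = (\<lambda>c. {indicator M | M. c \<in> seqs k \<and> infinite M \<and> (\<exists>j. \<forall>n\<in>M. c n = j)})\<rparr>"

end

theory Submission
  imports Defs
begin

text \<open>
  The factor \<open>lim\<close> can deliver the limit coloring \<open>d\<close> itself, so the only other information a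
  solution of the jump carries is a color \<open>i < k\<close> occurring infinitely often in \<open>d\<close>. Each color \<open>i\<close>
  yields a stream of guesses, the guess at stage \<open>s\<close> depending only on the first \<open>s\<close> entries of
  the input \<open>c\<close>; for the right \<open>i\<close>, the stream converges to a cluster point of \<open>c\<close>. Choosing each
  \<open>c s \<le> k\<close> different from the \<open>k\<close> current guesses makes that impossible.
\<close>

section \<open>Continuity of recursive functionals and approximation of limits\<close>

lemma minim_eq_Some_iff:
  "minim \<Phi> p xs = Some n \<longleftrightarrow>
     \<Phi> p (n # xs) = Some 0 \<and> (\<forall>m<n. \<exists>v. \<Phi> p (m # xs) = Some (Suc v))"
proof -
  let ?P = "\<lambda>n. \<Phi> p (n # xs) = Some 0 \<and> (\<forall>m<n. \<exists>v. \<Phi> p (m # xs) = Some (Suc v))"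
  have uniq: "m = n" if "?P m" "?P n" for m n
    using that by (metis linorder_neqE_nat nat.distinct(1) option.inject)
  have the: "(THE n. ?P n) = n" if "?P n" for n
    using that uniq by (intro the_equality) blast+
  show ?thesis
    unfolding minim_def Let_def using the by (auto split: if_splits)
qed

text \<open>A halting computation queries only finitely many oracle values. In the induction every
  case intersects finitely many neighbourhoods of \<open>p\<close>; minimisation with result
  \<open>v\<close> inspects only the tests at arguments up to \<open>v\<close>.\<close>

lemma recursive_eventually_eq:
  assumes "recursive \<Phi>" "\<Phi> p xs = Some v"
  shows "\<forall>\<^sub>F q in nhds p. \<Phi> q xs = Some v"
  using assms
proof (induction arbitrary: xs v rule: recursive.induct)
  case query
  then obtain x where x: "xs = [x]" "v = p x"
    by (auto split: list.splits)
  have "open ((\<lambda>q :: baire. q x) -` {p x})"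
    by (intro open_vimage open_discrete continuous_on_product_coordinates)
  then have "\<forall>\<^sub>F q in nhds p. q \<in> (\<lambda>q. q x) -` {p x}"
    by (rule eventually_nhds_in_open) simp
  then show ?case
    by eventually_elim (simp add: x)
next
  case (comp \<Phi> \<Psi>s)
  then obtain vs where vs: "those (map (\<lambda>\<Psi>. \<Psi> p xs) \<Psi>s) = Some vs" "\<Phi> p vs = Some v"
    by (auto simp: bind_eq_Some_conv)
  have "\<forall>\<^sub>F q in nhds p. those (map (\<lambda>\<Psi>. \<Psi> q xs) \<Psi>s) = Some vs"
    using comp.IH(2) vs(1)
  proof (induction \<Psi>s arbitrary: vs)
    case (Cons \<Psi> \<Psi>s)
    from Cons.prems(2) obtain w ws where w: "\<Psi> p xs = Some w"
      "those (map (\<lambda>\<Psi>. \<Psi> p xs) \<Psi>s) = Some ws" "vs = w # ws"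
      by (auto split: option.splits)
    have "\<forall>\<^sub>F q in nhds p. \<Psi> q xs = Some w"
      using Cons.prems(1) w(1) by simp
    moreover have "\<forall>\<^sub>F q in nhds p. those (map (\<lambda>\<Psi>. \<Psi> q xs) \<Psi>s) = Some ws"
      using Cons.IH[OF _ w(2)] Cons.prems(1) by simp
    ultimately show ?case
      by eventually_elim (simp add: w(3))
  qed simp
  moreover have "\<forall>\<^sub>F q in nhds p. \<Phi> q vs = Some v"
    using comp.IH(1) vs(2) by blast
  ultimately show ?case
    by eventually_elim simp
next
  case (prec \<Phi> \<Psi>)
  then obtain x ys where xs: "xs = x # ys"
    by (cases xs) (auto simp: prec_def)
  define R where "R = (\<lambda>q. rec_nat (\<Phi> q ys) (\<lambda>n r. Option.bind r (\<lambda>v. \<Psi> q (n # v # ys))))"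
  have "\<forall>\<^sub>F q in nhds p. R q x = Some w" if "R p x = Some w" for w
    using that
  proof (induction x arbitrary: w)
    case 0
    then show ?case
      using prec.IH(1) by (simp add: R_def)
  next
    case (Suc x)
    then obtain u where u: "R p x = Some u" "\<Psi> p (x # u # ys) = Some w"
      by (auto simp: R_def bind_eq_Some_conv)
    then show ?case
      using Suc.IH[OF u(1)] prec.IH(2)[OF u(2)]
      by (auto simp: R_def elim: eventually_elim2)
  qed
  then show ?case
    using prec.prems by (simp add: xs prec_def R_def)
next
  case (minim \<Phi>)
  then have 0: "\<Phi> p (v # xs) = Some 0" "\<forall>m<v. \<exists>w. \<Phi> p (m # xs) = Some (Suc w)"
    by (simp_all add: minim_eq_Some_iff)
  have "\<forall>\<^sub>F q in nhds p. \<forall>m\<in>{..<v}. \<exists>w. \<Phi> q (m # xs) = Some (Suc w)"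
  proof (rule eventually_ball_finite, simp, rule ballI)
    fix m assume "m \<in> {..<v}"
    then obtain w where "\<Phi> p (m # xs) = Some (Suc w)"
      using 0(2) by blast
    then show "\<forall>\<^sub>F q in nhds p. \<exists>w. \<Phi> q (m # xs) = Some (Suc w)"
      using minim.IH by (blast intro: eventually_mono)
  qed
  then show ?case
    using minim.IH[OF 0(1)] by eventually_elim (simp add: minim_eq_Some_iff)
qed auto

text \<open>Cylinders form a neighbourhood base: otherwise each cylinder of length \<open>u\<close>
  around \<open>p\<close> contains a counterexample \<open>X u\<close>, and these counterexamples
  converge to \<open>p\<close>.\<close>

lemma eventually_nhds_baireD:
  fixes p :: baire
  assumes "eventually P (nhds p)"
  obtains u where "\<And>q. (\<And>n. n < u \<Longrightarrow> q n = p n) \<Longrightarrow> P q"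
proof (rule ccontr)
  assume "\<not> thesis"
  then have "\<forall>u. \<exists>q. (\<forall>n<u. q n = p n) \<and> \<not> P q"
    using that by blast
  then obtain X where X: "\<And>u n. n < u \<Longrightarrow> X u n = p n" "\<And>u. \<not> P (X u)"
    by metis
  have "X \<longlonglongrightarrow> p"
    unfolding baire_tendsto_iff
    by (intro allI eventually_mono[OF eventually_gt_at_top] X(1))
  then have "\<forall>\<^sub>F u in sequentially. P (X u)"
    using assms by (rule filterlim_iff[THEN iffD1, rule_format])
  then show False
    using X(2) by simp
qed

text \<open>
  The approximation reads at stage \<open>s\<close> the last term of index at most \<open>s\<close> that is already
  determined by the first \<open>s\<close> entries of the input.
\<close>

lemma recursive_limit_approximation:
  assumes "recursive \<Phi>"
  obtains A :: "nat \<Rightarrow> baire \<Rightarrow> baire" where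
    "\<And>s p q. (\<And>n. n < s \<Longrightarrow> p n = q n) \<Longrightarrow> A s p = A s q"
    "\<And>p X d. (\<And>t m. \<Phi> p [h t m] = Some (X t m)) \<Longrightarrow> X \<longlonglongrightarrow> d \<Longrightarrow> (\<lambda>s. A s p) \<longlonglongrightarrow> d"
proof -
  \<comment> \<open>Quantifying over all oracles that share the prefix replaces counting computation
    steps. The approximation need not be computable; only its dependence on finite prefixes
    matters.\<close>
  define forced where "forced s p t m v \<longleftrightarrow>
    (\<forall>q. (\<forall>n<s. q n = p n) \<longrightarrow> \<Phi> q [h t m] = Some v)" for s p t m v
  define T where "T s p m = {t. t \<le> s \<and> (\<exists>v. forced s p t m v)}" for s p m
  define A where "A s p m = (THE v. forced s p (Max (T s p m)) m v)" for s p m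
  show thesis
  proof
    fix s and p q :: baire assume "\<And>n. n < s \<Longrightarrow> p n = q n"
    then have "forced s p = forced s q"
      by (auto simp: forced_def fun_eq_iff)
    then show "A s p = A s q"
      by (simp add: A_def T_def fun_eq_iff)
  next
    fix p X d assume \<Phi>: "\<And>t m. \<Phi> p [h t m] = Some (X t m)" and X: "X \<longlonglongrightarrow> d"
    \<comment> \<open>The oracle \<open>p\<close> is itself among the \<open>q\<close>, so a forced
      value is the true one.\<close>
    have forced_eq: "v = X t m" if "forced s p t m v" for s t m v
      using that \<Phi> by (auto simp: forced_def)
    show "(\<lambda>s. A s p) \<longlonglongrightarrow> d"
      unfolding baire_tendsto_iff
    proof
      fix m
      obtain N where N: "\<And>t. t \<ge> N \<Longrightarrow> X t m = d m"
        using X by (auto simp: baire_tendsto_iff eventually_sequentially)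
      obtain u where u: "\<And>q. (\<And>n. n < u \<Longrightarrow> q n = p n) \<Longrightarrow> \<Phi> q [h N m] = Some (X N m)"
        using eventually_nhds_baireD[OF recursive_eventually_eq[OF assms \<Phi>]] by metis
      \<comment> \<open>From stage \<open>max N u\<close> on, the term of index \<open>N\<close> is
        determined at \<open>m\<close>. The term selected there has index at least \<open>N\<close>,
        hence already agrees with \<open>d\<close> at \<open>m\<close>.\<close>
      have "A s p m = d m" if s: "s \<ge> max N u" for s
      proof -
        have "N \<in> T s p m"
          using u s by (auto simp: T_def forced_def)
        moreover have "finite (T s p m)"
          by (simp add: T_def)
        ultimately have "Max (T s p m) \<in> T s p m" "N \<le> Max (T s p m)"
          by (auto intro: Max_in)
        then obtain v where v: "forced s p (Max (T s p m)) m v" "N \<le> Max (T s p m)"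
          by (auto simp: T_def)
        then have "A s p m = v"
          unfolding A_def using forced_eq by (metis the_equality)
        then show ?thesis
          using forced_eq[OF v(1)] N[OF v(2)] by simp
      qed
      then show "\<forall>\<^sub>F s in sequentially. A s p m = d m"
        unfolding eventually_sequentially by blast
    qed
  qed
qed

section \<open>Convergence of the approximate inputs\<close>

lemma bpair_tendsto:
  assumes "X \<longlonglongrightarrow> p" "Y \<longlonglongrightarrow> q"
  shows "(\<lambda>s. bpair (X s) (Y s)) \<longlonglongrightarrow> bpair p q"
  using assms by (simp add: baire_tendsto_iff bpair_def)

text \<open>Entry \<open>n\<close> depends on the color of \<open>n\<close> alone. The fibers of the
  approximating colorings may be finite; only convergence is claimed.\<close>

lemma indicator_tendsto:
  fixes X :: "nat \<Rightarrow> baire"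
  assumes "X \<longlonglongrightarrow> d"
  shows "(\<lambda>s. indicator {n. X s n = i}) \<longlonglongrightarrow> (indicator {n. d n = i} :: baire)"
  unfolding baire_tendsto_iff
proof
  fix n
  have "\<forall>\<^sub>F s in sequentially. X s n = d n"
    using assms by (simp add: baire_tendsto_iff)
  then show "\<forall>\<^sub>F s in sequentially. indicator {n. X s n = i} n = (indicator {n. d n = i} n :: nat)"
    by eventually_elim (simp add: indicator_def)
qed

lemma truncation_tendsto: "(\<lambda>s n. if n < s then p n else 0) \<longlonglongrightarrow> (p :: baire)"
  unfolding baire_tendsto_iff
proof
  fix j
  show "\<forall>\<^sub>F s in sequentially. (if j < s then p j else 0) = p j"
    using eventually_gt_at_top[of j] by eventually_elim simp
qed

section \<open>Diagonalization against \<open>k\<close> guesses\<close>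

lemma seqs_infinite_fiber:
  assumes "d \<in> seqs k"
  shows "\<exists>i<k. infinite {n. d n = i}"
proof (rule ccontr)
  assume "\<not> ?thesis"
  then have "finite (\<Union>i<k. {n. d n = i})"
    by blast
  moreover have "(\<Union>i<k. {n. d n = i}) = UNIV"
    using assms by (auto simp: seqs_def)
  ultimately show False
    by simp
qed

text \<open>The guesses at stage \<open>s\<close> see only earlier entries, so \<open>c\<close> can
  be chosen by course-of-values recursion; by pigeonhole, \<open>k\<close> guesses leave one of the
  \<open>k + 1\<close> values free.\<close>

lemma ex_sequence_avoiding:
  fixes g :: "nat \<Rightarrow> nat \<Rightarrow> baire \<Rightarrow> nat"
  assumes "\<And>i s p q. (\<And>n. n < s \<Longrightarrow> p n = q n) \<Longrightarrow> g i s p = g i s q"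
  obtains c where "c \<in> seqs (k + 1)" "\<And>i s. i < k \<Longrightarrow> c s \<noteq> g i s c"
proof -
  have "\<exists>c. \<forall>s. c s < k + 1 \<and> c s \<notin> (\<lambda>i. g i s c) ` {..<k}"
  proof (rule dependent_wellorder_choice)
    fix r :: nat and p q :: baire and s
    assume "\<And>n. n < s \<Longrightarrow> p n = q n"
    then show "(r < k + 1 \<and> r \<notin> (\<lambda>i. g i s p) ` {..<k}) =
        (r < k + 1 \<and> r \<notin> (\<lambda>i. g i s q) ` {..<k})"
      using assms[of s p q] by simp
  next
    fix s and p :: baire
    have "card ((\<lambda>i. g i s p) ` {..<k}) \<le> k"
      using card_image_le[of "{..<k}" "\<lambda>i. g i s p"] by simp
    then have "\<not> {..<k + 1} \<subseteq> (\<lambda>i. g i s p) ` {..<k}"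
      using card_mono[of "(\<lambda>i. g i s p) ` {..<k}" "{..<k + 1}"] by fastforce
    then show "\<exists>r. r < k + 1 \<and> r \<notin> (\<lambda>i. g i s p) ` {..<k}"
      by blast
  qed
  then show thesis
    using that unfolding seqs_def by blast
qed

section \<open>A realizer that answers with full color classes\<close>

text \<open>A reduction must work with every realizer, so it may be tested on one whose answer is
  fixed by both limits and a single color. Leaving \<open>G\<close> undefined elsewhere gives every
  answer this form.\<close>

lemma ex_realizer:
  obtains G where "realizes G (jump (RT1 k) \<times>\<^sub>W lim_problem)"
    "\<And>r s. G r = Some s \<Longrightarrow> \<exists>i d e. i < k \<and> column (bfst r) \<longlonglongrightarrow> d \<and> column (bsnd r) \<longlonglongrightarrow> e \<and>
      s = bpair (indicator {n. d n = i}) e"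
proof -
  define col where "col d = (SOME i. i < k \<and> infinite {n. d n = i})" for d :: baire
  have col: "col d < k" "infinite {n. d n = col d}" if "d \<in> seqs k" for d
    using someI_ex[OF seqs_infinite_fiber[OF that]] by (simp_all add: col_def)
  define G where "G r = Option.bind (lim_map (bfst r)) (\<lambda>d. Option.bind (lim_map (bsnd r))
    (\<lambda>e. if d \<in> seqs k then Some (bpair (indicator {n. d n = col d}) e) else None))" for r
  show thesis
  proof
    show "realizes G (jump (RT1 k) \<times>\<^sub>W lim_problem)"
      unfolding realizes_def
    proof (intro allI impI, elim conjE)
      fix r x
      assume r: "in_rep (jump (RT1 k) \<times>\<^sub>W lim_problem) r = Some x"
        and x: "sol (jump (RT1 k) \<times>\<^sub>W lim_problem) x \<noteq> {}"
      from r obtain d where d: "lim_map (bfst r) = Some d" "d \<in> seqs k" "x = (d, bsnd r)"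
        by (auto simp: problem_prod_def jump_def RT1_def lim_problem_def rep_prod_def
            rep_seqs_def restrict_map_def map_comp_def bind_eq_Some_conv split: if_splits
            option.splits)
      \<comment> \<open>Names for the factor \<open>lim\<close> are unrestricted, so convergence of
        the second half comes from solvability of the instance.\<close>
      from x obtain e where e: "lim_map (bsnd r) = Some e"
        by (auto simp: d(3) problem_prod_def lim_problem_def)
      let ?M = "{n. d n = col d}"
      have "G r = Some (bpair (indicator ?M) e)"
        using d e by (simp add: G_def)
      moreover have "out_rep (jump (RT1 k) \<times>\<^sub>W lim_problem) (bpair (indicator ?M) e) =
          Some (indicator ?M, e)"
        by (auto simp: problem_prod_def jump_def RT1_def lim_problem_def rep_prod_def
            rep_seqs_def restrict_map_def seqs_def indicator_def)
      moreover have "(indicator ?M, e) \<in> sol (jump (RT1 k) \<times>\<^sub>W lim_problem) x"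
        using col(2)[OF d(2)] d e
        by (auto simp: problem_prod_def jump_def RT1_def lim_problem_def)
      ultimately show "\<exists>q y. G r = Some q \<and>
          out_rep (jump (RT1 k) \<times>\<^sub>W lim_problem) q = Some y \<and>
          y \<in> sol (jump (RT1 k) \<times>\<^sub>W lim_problem) x"
        by blast
    qed
  next
    fix r s assume "G r = Some s"
    then show "\<exists>i d e. i < k \<and> column (bfst r) \<longlonglongrightarrow> d \<and> column (bsnd r) \<longlonglongrightarrow> e \<and>
        s = bpair (indicator {n. d n = i}) e"
      using col(1) unfolding G_def lim_map_eq_Some_iff[symmetric]
      by (auto simp: bind_eq_Some_conv split: if_splits)
  qed
qed

section \<open>The contradiction\<close>

theorem theorem6p5:
  fixes k :: nat
  assumes "k \<ge> 1"
  shows "\<not> BWT (k + 1) \<le>\<^sub>W jump (RT1 k) \<times>\<^sub>W lim_problem"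
proof
  assume "BWT (k + 1) \<le>\<^sub>W jump (RT1 k) \<times>\<^sub>W lim_problem"
  then obtain H K where "computable H" "computable K" and
    reduction: "\<And>G. realizes G (jump (RT1 k) \<times>\<^sub>W lim_problem) \<Longrightarrow>
      realizes (\<lambda>p. Option.bind (K p) (\<lambda>r. Option.bind (G r) (\<lambda>s. H (bpair p s)))) (BWT (k + 1))"
    unfolding weihrauch_le_def by blast
  then obtain \<Phi> \<Psi> where \<Phi>: "recursive \<Phi>" "\<And>p q n. H p = Some q \<Longrightarrow> \<Phi> p [n] = Some (q n)"
    and \<Psi>: "recursive \<Psi>" "\<And>p q n. K p = Some q \<Longrightarrow> \<Psi> p [n] = Some (q n)"
    unfolding computable_def by metis
  \<comment> \<open>Even positions of \<open>K p\<close> hold the name of the coloring, odd ones the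
    input of \<open>lim\<close>. So \<open>A\<close> approximates the coloring and \<open>B\<close>
    the answer of \<open>lim\<close>.\<close>
  obtain A :: "nat \<Rightarrow> baire \<Rightarrow> baire" where
    A_cong: "\<And>s p q. (\<And>n. n < s \<Longrightarrow> p n = q n) \<Longrightarrow> A s p = A s q" and
    A_lim: "\<And>p X d. (\<And>t m. \<Psi> p [2 * prod_encode (t, m)] = Some (X t m)) \<Longrightarrow>
      X \<longlonglongrightarrow> d \<Longrightarrow> (\<lambda>s. A s p) \<longlonglongrightarrow> d"
    using recursive_limit_approximation[OF \<Psi>(1), of "\<lambda>t m. 2 * prod_encode (t, m)"] by blast
  obtain B :: "nat \<Rightarrow> baire \<Rightarrow> baire" where
    B_cong: "\<And>s p q. (\<And>n. n < s \<Longrightarrow> p n = q n) \<Longrightarrow> B s p = B s q" and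
    B_lim: "\<And>p X d. (\<And>t m. \<Psi> p [2 * prod_encode (t, m) + 1] = Some (X t m)) \<Longrightarrow>
      X \<longlonglongrightarrow> d \<Longrightarrow> (\<lambda>s. B s p) \<longlonglongrightarrow> d"
    using recursive_limit_approximation[OF \<Psi>(1), of "\<lambda>t m. 2 * prod_encode (t, m) + 1"] by blast
  \<comment> \<open>The stage \<open>s\<close> approximation to the input of \<open>H\<close> if the
    color is \<open>i\<close>. Truncating \<open>p\<close> keeps it dependent on the first
    \<open>s\<close> entries only.\<close>
  define x where "x i s p = bpair (\<lambda>n. if n < s then p n else 0)
    (bpair (indicator {n. A s p n = i}) (B s p))" for i s p
  \<comment> \<open>Where \<Phi> is undefined the guess is an unspecified number; avoiding it does
    no harm.\<close>
  define g where "g i s p = the (\<Phi> (x i s p) [0])" for i s p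
  have g_cong: "g i s p = g i s q" if "\<And>n. n < s \<Longrightarrow> p n = q n" for i s p q
  proof -
    have "(\<lambda>n. if n < s then p n else 0) = (\<lambda>n. if n < s then q n else 0)"
      using that by auto
    then show ?thesis
      unfolding g_def x_def using A_cong[OF that] B_cong[OF that] by simp
  qed
  obtain c where c: "c \<in> seqs (k + 1)" "\<And>i s. i < k \<Longrightarrow> c s \<noteq> g i s c"
    using ex_sequence_avoiding[of g k] g_cong by blast
  obtain G where G: "realizes G (jump (RT1 k) \<times>\<^sub>W lim_problem)"
    "\<And>r s. G r = Some s \<Longrightarrow> \<exists>i d e. i < k \<and> column (bfst r) \<longlonglongrightarrow> d \<and> column (bsnd r) \<longlonglongrightarrow> e \<and>
      s = bpair (indicator {n. d n = i}) e"
    using ex_realizer[of k] by blast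
  have "in_rep (BWT (k + 1)) c = Some c" "sol (BWT (k + 1)) c \<noteq> {}"
    using c(1) seqs_infinite_fiber[OF c(1)] by (auto simp: BWT_def rep_seqs_def)
  then obtain r s q j where r: "K c = Some r" "G r = Some s" "H (bpair c s) = Some q"
    and j: "out_rep (BWT (k + 1)) q = Some j" "j \<in> sol (BWT (k + 1)) c"
    using reduction[OF G(1), unfolded realizes_def, rule_format, of c c]
    by (auto simp: bind_eq_Some_conv)
  have q0: "q 0 = j"
    using j(1) by (simp add: BWT_def rep_fin_def split: if_splits)
  have inf: "infinite {n. c n = j}"
    using j(2) by (simp add: BWT_def)
  obtain i d e where i: "i < k" and d: "column (bfst r) \<longlonglongrightarrow> d" and e: "column (bsnd r) \<longlonglongrightarrow> e"
    and s: "s = bpair (indicator {n. d n = i}) e"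
    using G(2)[OF r(2)] by blast
  have "(\<lambda>t. A t c) \<longlonglongrightarrow> d"
    using A_lim[OF _ d] \<Psi>(2)[OF r(1)] by (simp add: column_def bfst_def)
  moreover have "(\<lambda>t. B t c) \<longlonglongrightarrow> e"
    using B_lim[OF _ e] \<Psi>(2)[OF r(1)] by (simp add: column_def bsnd_def)
  ultimately have "(\<lambda>t. x i t c) \<longlonglongrightarrow> bpair c s"
    unfolding x_def s by (intro bpair_tendsto indicator_tendsto truncation_tendsto)
  \<comment> \<open>The answer \<open>j\<close> is read off entry 0 of the output of
    \<open>H\<close>, so it is settled by a finite prefix and is also produced from all sufficiently
    late approximations.\<close>
  moreover have "\<forall>\<^sub>F p in nhds (bpair c s). \<Phi> p [0] = Some j"
    using recursive_eventually_eq[OF \<Phi>(1)] \<Phi>(2)[OF r(3)] q0 by blast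
  ultimately have "\<forall>\<^sub>F t in sequentially. \<Phi> (x i t c) [0] = Some j"
    by (rule filterlim_iff[THEN iffD1, rule_format])
  \<comment> \<open>The guess for the color \<open>i\<close> is eventually \<open>j\<close>, and
    \<open>c\<close> was built to avoid it at every stage.\<close>
  then have "\<forall>\<^sub>F t in sequentially. c t \<noteq> j"
  proof eventually_elim
    case (elim t)
    then show ?case
      using c(2)[OF i, of t] by (simp add: g_def)
  qed
  moreover have "\<exists>\<^sub>F t in sequentially. c t = j"
    using inf by (simp add: frequently_cofinite cofinite_eq_sequentially[symmetric])
  ultimately show False
    by (simp add: frequently_def)
qed

end
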